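(* Let $P\in\mathcal{K}^2$ be an origin-symmetric lattice polygon, i.e., $-P=P$ and $P$ is the convex hull of finitely many points of $\mathbb{Z}^2$. Let $\lambda_i=\lambda_i(P)$, $i=1,2$, be its successive minima. Then $$\mathrm{G}(\mathrm{int}\,P)\geq\mathrm{vol}(P)\left(1-\frac{\lambda_1}{2}\right)\left(1-\frac{\lambda_2}{2}\right).$$
   Context: $\mathcal{K}^2$ is the class of all compact convex sets in $\mathbb{R}^2$ with non-empty interior. For $A\subseteq\mathbb{R}^2$, $\mathrm{G}(A)=|A\cap\mathbb{Z}^2|$ is the number of integer points in $A$; $\mathrm{vol}$ is the area and $\mathrm{int}$ denotes the interior. For $K\in\mathcal{K}^2$ with $K=-K$, the $i$-th successive minimum is $\lambda_i(K)=\min\{\lambda>0:\dim(\lambda K\cap\mathbb{Z}^2)\geq i\}$, $i=1,2$, where $\dim$ of a set of lattice points in the symmetric body is the dimension of its linear span. *)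

theory Defs
  imports "HOL-Analysis.Analysis"
begin

definition convex_bodies :: "(real ^ 2) set set" where
  "convex_bodies = {K. compact K \<and> convex K \<and> interior K \<noteq> {}}"

definition integer_lattice :: "(real ^ 2) set" where
  "integer_lattice = {x. \<forall>j. x $ j \<in> \<int>}"

(* Only meaningful for sets with finitely many integer points, e.g. bounded sets:
   card of an infinite set is 0. *)
definition lattice_point_count :: "(real ^ 2) set \<Rightarrow> nat" where
  "lattice_point_count A = card (A \<inter> integer_lattice)"

definition lattice_polygon :: "(real ^ 2) set \<Rightarrow> bool" where
  "lattice_polygon P \<longleftrightarrow> (\<exists>V. finite V \<and> V \<subseteq> integer_lattice \<and> P = convex hull V)"

definition origin_symmetric :: "(real ^ 2) set \<Rightarrow> bool" where
  "origin_symmetric K \<longleftrightarrow> uminus ` K = K"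

(* LEAST denotes the minimum of a set of reals and is unspecified if none exists. For an
   origin-symmetric convex body and i = 1, 2 the minimum exists, since every dilate of K
   is compact and so contains only finitely many integer points.
   The constant dim is the dimension of the linear span. *)
definition successive_minimum :: "nat \<Rightarrow> (real ^ 2) set \<Rightarrow> real" where
  "successive_minimum i K =
     (LEAST l. l > 0 \<and> dim (((*\<^sub>R) l ` K) \<inter> integer_lattice) \<ge> i)"

end

(*
  Choose a nonzero integer functional u whose maximum H on P is minimal. It is primitive, so after
  a unimodular change of coordinates u is the height y. Let r j be the right end of the slice at
  the integer height j, n the length of the top edge, and a = r 0. As all vertices have integer
  heights, the trapezoid rule gives vol P = 2 (sum of r j over |j| < H) + n, while the interior has
  at least 2 (sum of ceiling (r j) over |j| < H) - (2 H - 1) lattice points. Any two independent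
  lattice vectors include one off the line y = 0, so lambda_2 >= 1 / H, and similarly
  lambda_1 >= 1 / max a H. It remains to bound the number of lattice points below in terms of H
  and a.
  If a >= H, it suffices to drop the ceilings and to use vol P >= 2 a H + n H. If a < H, the losses
  in the ceilings are needed, as in Pick's theorem: every edge line has lattice distance at
  least H from the origin by minimality of H, which yields at least vol P (1 - 1 / H) + 1 interior
  lattice points, and vol P <= 4 H^2 because every slice has length at most 2 a.
*)
theory Submission
  imports Defs
begin

section \<open>Symmetric boundary profiles\<close>

text \<open>The two factors multiply to \<open>1 - k\<close> with \<open>k >= 0\<close>, so the
  lower bound on \<open>T\<close> may be inserted into \<open>T * k\<close>. What
  \<open>T * k\<close> then has beyond \<open>n + 2 * h - 1\<close> is
  \<open>(M - h + 1 / 2) * (1 - n / (2 * M))\<close>, a product of nonnegative terms.\<close>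

lemma crude_factor_bound:
  fixes h M n T :: real
  assumes "1 \<le> h" "h \<le> M" "n \<le> 2 * M" "2 * M * h + n * h \<le> T"
  shows "T * (1 - 1 / (2 * M)) * (1 - 1 / (2 * h)) \<le> T - n - (2 * h - 1)"
proof -
  define x where "x = 1 / M"
  define y where "y = 1 / h"
  define k where "k = x / 2 + y / 2 - x * y / 4"
  have x: "M * x = 1" "0 \<le> x" and y: "h * y = 1" "0 \<le> y" "y \<le> 1"
    using assms by (auto simp: x_def y_def)
  have "x * y \<le> x * 1"
    using x y by (intro mult_left_mono) auto
  then have "0 \<le> k"
    using x y unfolding k_def by linarith
  then have "(2 * M * h + n * h) * k \<le> T * k"
    using assms by (intro mult_right_mono) auto
  moreover have "(2 * M * h + n * h) * k
      = (M * x) * h + M * (h * y) - (M * x) * (h * y) / 2 + n * h * x / 2 + n * (h * y) / 2 - n * x * (h * y) / 4"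
    by (simp add: k_def field_simps)
  moreover have "(M - h) * (1 - n * x / 2) = M - h - (M * x) * n / 2 + n * h * x / 2"
    by (simp add: field_simps)
  moreover have "n * x \<le> 2 * M * x"
    using assms x by (intro mult_right_mono) auto
  then have "0 \<le> 1 - n * x / 2"
    using x by simp
  moreover from this have "0 \<le> (M - h) * (1 - n * x / 2)"
    using assms by simp
  moreover have "T * (1 - 1 / (2 * M)) * (1 - 1 / (2 * h)) = T - T * k"
  proof -
    have inverses: "1 / (2 * M) = x / 2" "1 / (2 * h) = y / 2"
      by (simp_all add: x_def y_def)
    show ?thesis
      unfolding inverses k_def by (simp add: field_simps)
  qed
  ultimately show ?thesis
    using x(1) y(1) by simp
qed

text \<open>
  \<open>r j\<close> is the right end of the slice at height \<open>j\<close>; by symmetry the left end is \<open>- r (- j)\<close>.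
\<close>

locale boundary_profile =
  fixes r :: "int \<Rightarrow> real" and H :: int
  assumes H_pos: "0 < H"
    and concave: "\<And>i j k. \<lbrakk>- H \<le> i; i < j; j < k; k \<le> H\<rbrakk> \<Longrightarrow>
      real_of_int (k - j) * r i + real_of_int (j - i) * r k \<le> real_of_int (k - i) * r j"
    and no_vertex: "\<And>j. \<lbrakk>- H < j; j < H; r j \<notin> \<int>\<rbrakk> \<Longrightarrow> 2 * r j \<le> r (j - 1) + r (j + 1)"
    and ends_Ints: "r H \<in> \<int>" "r (- H) \<in> \<int>"
    and width: "\<And>p q. 0 < q \<Longrightarrow> \<exists>i. - H \<le> i \<and> i \<le> H \<and>
      real_of_int H \<le> real_of_int q * r i - real_of_int p * real_of_int i"
begin

section \<open>Slice lengths and the trapezoid sum\<close>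

definition trapezoid_sum :: real where
  "trapezoid_sum = 2 * (\<Sum>j\<in>{- H<..<H}. r j) + (r H + r (- H))"

lemma sum_reflect: "(\<Sum>j\<in>{- H<..<H}. f (- j)) = (\<Sum>j\<in>{- H<..<H}. f j)"
  for f :: "int \<Rightarrow> real"
  by (rule sum.reindex_bij_witness[of _ uminus uminus]) auto

lemma middle_ge: "r H + r (- H) \<le> 2 * r 0"
proof -
  have "real_of_int H * r (- H) + real_of_int H * r H \<le> real_of_int (H + H) * r 0"
    using concave[of "- H" 0 H] H_pos by simp
  then have "real_of_int H * (r H + r (- H)) \<le> real_of_int H * (2 * r 0)"
    by (simp add: algebra_simps)
  then show ?thesis
    using H_pos by simp
qed

text \<open>The slice length \<open>r j + r (- j)\<close> is a sum of two concave functions of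
  \<open>j\<close>, so it lies above its chord between height \<open>0\<close> and the nearer
  end.\<close>

lemma pair_lower:
  assumes "- H < j" "j < H"
  shows "2 * r 0 * (1 - \<bar>real_of_int j\<bar> / H) + (r H + r (- H)) * (\<bar>real_of_int j\<bar> / H) \<le> r j + r (- j)"
proof -
  have *: "2 * r 0 * (1 - real_of_int j / H) + (r H + r (- H)) * (real_of_int j / H) \<le> r j + r (- j)"
    if j: "0 < j" "j < H" for j
  proof -
    have "real_of_int (H - j) * r 0 + real_of_int j * r H \<le> real_of_int H * r j"
      using concave[of 0 j H] j by simp
    moreover have "real_of_int j * r (- H) + real_of_int (H - j) * r 0 \<le> real_of_int H * r (- j)"
      using concave[of "- H" "- j" 0] j by simp
    ultimately have "real_of_int (H - j) * (2 * r 0) + real_of_int j * (r H + r (- H))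
        \<le> (r j + r (- j)) * real_of_int H"
      by (simp add: algebra_simps)
    then have "(real_of_int (H - j) * (2 * r 0) + real_of_int j * (r H + r (- H))) / H \<le> r j + r (- j)"
      using H_pos by (simp add: pos_divide_le_eq)
    then show ?thesis
      using H_pos by (simp add: add_divide_distrib diff_divide_distrib algebra_simps)
  qed
  show ?thesis
    using *[of j] *[of "- j"] assms by (cases j "0 :: int" rule: linorder_cases) auto
qed

lemma pair_upper:
  assumes "- H < j" "j < H"
  shows "r j + r (- j) \<le> 2 * r 0"
proof -
  have *: "r j + r (- j) \<le> 2 * r 0" if j: "0 < j" "j < H" for j
  proof -
    have "real_of_int j * r (- j) + real_of_int j * r j \<le> real_of_int (2 * j) * r 0"
      using concave[of "- j" 0 j] j by simp
    then have "real_of_int j * (r j + r (- j)) \<le> real_of_int j * (2 * r 0)"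
      by (simp add: algebra_simps)
    then show ?thesis
      using j by simp
  qed
  show ?thesis
    using *[of j] *[of "- j"] assms by (cases j "0 :: int" rule: linorder_cases) auto
qed

text \<open>In this form the sum is visibly the trapezoid rule for the slice lengths
  \<open>r j + r (- j)\<close>, with the two equal end slices counted by half each.\<close>

lemma trapezoid_sum_pairs:
  "trapezoid_sum = (\<Sum>j\<in>{- H<..<H}. r j + r (- j)) + (r H + r (- H))"
  by (simp add: trapezoid_sum_def sum.distrib sum_reflect)

lemma sum_abs: "(\<Sum>j\<in>{- H<..<H}. \<bar>real_of_int j\<bar>) = H * (H - 1)"
proof -
  have "(\<Sum>j\<in>{- k<..<k}. \<bar>real_of_int j\<bar>) = k * (k - 1)" if "1 \<le> k" for k :: int
    using that
  proof (induction k rule: int_ge_induct)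
    case base
    have "{- 1<..<1 :: int} = {0}" by auto
    then show ?case by simp
  next
    case (step k)
    have "{- (k + 1)<..<k + 1} = insert k (insert (- k) {- k<..<k})"
      using step.hyps by auto
    then show ?case
      using step by (simp add: algebra_simps)
  qed
  then show ?thesis
    using H_pos by simp
qed

text \<open>The left-hand side is the area of the two trapezoids of height \<open>H\<close> spanned
  by the middle slice and the horizontal edges. The weights in \<open>pair_lower\<close> sum to
  \<open>H\<close> for the middle slice and to \<open>H - 1\<close> for the edge, whose own term
  supplies the missing one.\<close>

lemma trapezoid_sum_ge: "2 * r 0 * H + (r H + r (- H)) * H \<le> trapezoid_sum"
proof -
  let ?n = "r H + r (- H)"
  have "(\<Sum>j\<in>{- H<..<H}. 2 * r 0 * (1 - \<bar>real_of_int j\<bar> / H) + ?n * (\<bar>real_of_int j\<bar> / H))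
      \<le> (\<Sum>j\<in>{- H<..<H}. r j + r (- j))"
    by (intro sum_mono pair_lower) auto
  moreover have "(\<Sum>j\<in>{- H<..<H}. 2 * r 0 * (1 - \<bar>real_of_int j\<bar> / H) + ?n * (\<bar>real_of_int j\<bar> / H))
      = 2 * r 0 * ((2 * H - 1) - (\<Sum>j\<in>{- H<..<H}. \<bar>real_of_int j\<bar>) / H)
        + ?n * ((\<Sum>j\<in>{- H<..<H}. \<bar>real_of_int j\<bar>) / H)"
    using H_pos
    by (simp add: sum.distrib sum_subtractf sum_distrib_left[symmetric] sum_divide_distrib[symmetric])
  moreover have "\<dots> = 2 * r 0 * H + ?n * (H - 1)"
    unfolding sum_abs using H_pos by (simp add: field_simps)
  ultimately show ?thesis
    by (simp add: trapezoid_sum_pairs algebra_simps)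
qed

lemma trapezoid_sum_le: "trapezoid_sum \<le> 4 * r 0 * H"
proof -
  have "(\<Sum>j\<in>{- H<..<H}. r j + r (- j)) \<le> (\<Sum>j\<in>{- H<..<H}. 2 * r 0)"
    by (intro sum_mono pair_upper) auto
  also have "\<dots> = 2 * r 0 * (2 * H - 1)"
    using H_pos by simp
  finally show ?thesis
    using middle_ge by (simp add: trapezoid_sum_pairs algebra_simps)
qed

section \<open>Rounding errors against cross products\<close>

text \<open>
  The cross products of consecutive boundary points add up to twice the area seen from the origin
  through the right boundary chain, that is, to the area of the polygon without the two triangles
  over its horizontal edges.
\<close>

definition defect :: "int \<Rightarrow> real" where
  "defect j = 2 * (\<lceil>r j\<rceil> - r j) + (r j * (j + 1) - r (j + 1) * j) / H - 1"

text \<open>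
  Between two consecutive lattice points of the boundary the profile is affine. The rounding
  errors at heights \<open>j\<close> and \<open>a + b - j\<close> add up to \<open>1\<close>, and the cross products add up to the
  value on the edge line of its integer normal, which is at least \<open>H\<close> by assumption \<open>width\<close>.
\<close>

lemma defect_gap:
  assumes "- H \<le> a" "a < b" "b \<le> H" and int: "r a \<in> \<int>" "r b \<in> \<int>"
    and gap: "\<And>j. a < j \<Longrightarrow> j < b \<Longrightarrow> r j \<notin> \<int>"
  shows "0 \<le> sum defect {a..<b}"
proof -
  define d where "d = r (a + 1) - r a"
  have line_step: "k < b \<longrightarrow> r (k + 1) = r k + d" if "a \<le> k" for k
    using that
  proof (induction k rule: int_ge_induct)
    case base
    then show ?case by (simp add: d_def)
  next
    case (step k)
    show ?case
    proof
      assume k: "k + 1 < b"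
      \<comment> \<open>Off the lattice \<open>no_vertex\<close> reverses concavity; the two
        together say that the slope does not change at \<open>k + 1\<close>.\<close>
      have "2 * r (k + 1) \<le> r k + r (k + 2)"
        using no_vertex[of "k + 1"] gap[of "k + 1"] k step.hyps assms by (simp add: add.commute)
      moreover have "r k + r (k + 2) \<le> 2 * r (k + 1)"
        using concave[of k "k + 1" "k + 2"] k step.hyps assms by simp
      moreover have "r (k + 1) = r k + d"
        using step.IH k by simp
      ultimately show "r (k + 1 + 1) = r (k + 1) + d"
        by (simp add: add.assoc)
    qed
  qed
  define c where "c = r a - a * d"
  have line: "k \<le> b \<longrightarrow> r k = c + k * d" if "a \<le> k" for k
    using that
  proof (induction k rule: int_ge_induct)
    case base
    then show ?case by (simp add: c_def)
  next
    case (step k)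
    then show ?case using line_step[of k]
      by (auto simp: algebra_simps)
  qed
  \<comment> \<open>A concave sequence lies below the line through two consecutive values, here
    those at \<open>a\<close> and \<open>a + 1\<close>.\<close>
  have support: "r i \<le> c + i * d" if "- H \<le> i" "i \<le> H" for i
  proof -
    consider "i < a" | "i = a" | "i = a + 1" | "a + 1 < i" by linarith
    then show ?thesis
    proof cases
      case 1
      then show ?thesis
        using concave[of i a "a + 1"] that assms by (simp add: c_def d_def algebra_simps)
    next
      case 4
      then show ?thesis
        using concave[of a "a + 1" i] that assms by (simp add: c_def d_def algebra_simps)
    qed (auto simp: c_def d_def algebra_simps)
  qed
  obtain A B where AB: "r a = of_int A" "r b = of_int B"
    using int by (auto elim!: Ints_cases)
  have slope: "real_of_int (B - A) = (b - a) * d"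
    using line[of b] line[of a] AB assms(2) by (simp add: algebra_simps)
  \<comment> \<open>The pair \<open>(b - a, - (B - A))\<close> is an integer normal of the edge. By
    \<open>support\<close> the lower bound \<open>H\<close> on its maximum passes to the edge line,
    where its value is \<open>(b - a) * c\<close>.\<close>
  obtain i where i: "- H \<le> i" "i \<le> H"
    "real_of_int H \<le> real_of_int (b - a) * r i - real_of_int (B - A) * real_of_int i"
    using width[of "b - a" "B - A"] assms(2) by auto
  have "real_of_int (b - a) * r i \<le> (b - a) * (c + i * d)"
    using support[OF i(1,2)] assms(2) by (intro mult_left_mono) auto
  then have H_le: "H \<le> (b - a) * c"
    using i(3) unfolding slope by (simp add: algebra_simps)
  have cross: "(r j * (j + 1) - r (j + 1) * j) / H = c / H" if "j \<in> {a..<b}" for j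
    using that line[of j] line[of "j + 1"] by (simp add: algebra_simps)
  have pair: "(\<lceil>r j\<rceil> - r j) + (\<lceil>r (a + b - j)\<rceil> - r (a + b - j)) = 1" if "j \<in> {a<..<b}" for j
  proof -
    have "r (a + b - j) = of_int (A + B) - r j"
      using that line[of j] line[of "a + b - j"] line[of a] line[of b] AB by (simp add: algebra_simps)
    moreover have "\<lceil>of_int (A + B) - r j\<rceil> = A + B - \<lfloor>r j\<rfloor>"
      by linarith
    moreover have "\<lceil>r j\<rceil> = \<lfloor>r j\<rfloor> + 1"
      using gap[of j] that by (simp add: ceiling_altdef) (metis Ints_of_int)
    ultimately show ?thesis by simp
  qed
  have "(\<Sum>j\<in>{a<..<b}. \<lceil>r j\<rceil> - r j) = (\<Sum>j\<in>{a<..<b}. \<lceil>r (a + b - j)\<rceil> - r (a + b - j))"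
    by (rule sum.reindex_bij_witness[of _ "\<lambda>j. a + b - j" "\<lambda>j. a + b - j"]) auto
  then have "2 * (\<Sum>j\<in>{a<..<b}. \<lceil>r j\<rceil> - r j)
      = (\<Sum>j\<in>{a<..<b}. (\<lceil>r j\<rceil> - r j) + (\<lceil>r (a + b - j)\<rceil> - r (a + b - j)))"
    unfolding sum.distrib by simp
  also have "\<dots> = (\<Sum>j\<in>{a<..<b}. 1)"
    by (rule sum.cong[OF refl pair])
  finally have "2 * (\<Sum>j\<in>{a<..<b}. \<lceil>r j\<rceil> - r j) = (\<Sum>j\<in>{a<..<b}. 1)" .
  then have "2 * (\<Sum>j\<in>{a<..<b}. \<lceil>r j\<rceil> - r j) = b - a - 1"
    using assms(2) by simp
  moreover have "{a..<b} = insert a {a<..<b}"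
    using assms(2) by auto
  ultimately have *: "(\<Sum>j\<in>{a..<b}. 2 * (\<lceil>r j\<rceil> - r j)) = b - a - 1"
    using AB by (simp add: sum_distrib_left right_diff_distrib)
  have "sum defect {a..<b} = (\<Sum>j\<in>{a..<b}. 2 * (\<lceil>r j\<rceil> - r j) + c / H - 1)"
    unfolding defect_def using cross by (intro sum.cong) auto
  also have "\<dots> = (b - a) * c / H - 1"
    unfolding sum_subtractf sum.distrib * using assms(2) by simp
  moreover have "1 \<le> (b - a) * c / H"
    using H_le H_pos by (simp add: pos_le_divide_eq)
  ultimately show ?thesis
    by linarith
qed

text \<open>The range splits at every inner height with an integer end, which leaves the gaps
  between consecutive lattice points treated in \<open>defect_gap\<close>.\<close>

lemma defect_nonneg:
  assumes "- H \<le> a" "a \<le> b" "b \<le> H" "r a \<in> \<int>" "r b \<in> \<int>"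
  shows "0 \<le> sum defect {a..<b}"
  using assms
proof (induction "nat (b - a)" arbitrary: a b rule: less_induct)
  case less
  show ?case
  proof (cases "\<exists>j. a < j \<and> j < b \<and> r j \<in> \<int>")
    case True
    then obtain j where j: "a < j" "j < b" "r j \<in> \<int>" by blast
    have "0 \<le> sum defect {a..<j}" "0 \<le> sum defect {j..<b}"
      using less j by auto
    moreover have "{a..<b} = {a..<j} \<union> {j..<b}" "{a..<j} \<inter> {j..<b} = {}"
      using j by auto
    ultimately show ?thesis
      by (simp add: sum.union_disjoint)
  next
    case False
    then show ?thesis
      using defect_gap[of a b] less.prems by (cases "a = b") auto
  qed
qed

text \<open>Shifting the index in the second product leaves the weight
  \<open>(j + 1) - (j - 1) = 2\<close> at each inner height; the rest are boundary terms at
  \<open>- H\<close> and \<open>H\<close>.\<close>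

lemma sum_cross: "(\<Sum>j\<in>{- H..<H}. r j * (j + 1) - r (j + 1) * j) = trapezoid_sum - (r H + r (- H)) * H"
proof -
  have "{- H..<H} = insert (- H) {- H<..<H}"
    using H_pos by auto
  then have 1: "(\<Sum>j\<in>{- H..<H}. r j * (j + 1)) = r (- H) * (1 - H) + (\<Sum>j\<in>{- H<..<H}. r j * (j + 1))"
    by (simp add: algebra_simps)
  have "(\<Sum>j\<in>{- H..<H}. r (j + 1) * j) = (\<Sum>j\<in>{- H<..H}. r j * (j - 1))"
    by (rule sum.reindex_bij_witness[of _ "\<lambda>j. j - 1" "\<lambda>j. j + 1"]) auto
  also have "{- H<..H} = insert H {- H<..<H}"
    using H_pos by auto
  finally have 2: "(\<Sum>j\<in>{- H..<H}. r (j + 1) * j) = r H * (H - 1) + (\<Sum>j\<in>{- H<..<H}. r j * (j - 1))"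
    by simp
  have "(\<Sum>j\<in>{- H<..<H}. r j * (j + 1)) - (\<Sum>j\<in>{- H<..<H}. r j * (j - 1)) = 2 * (\<Sum>j\<in>{- H<..<H}. r j)"
    by (simp add: sum_subtractf[symmetric] sum_distrib_left algebra_simps)
  then show ?thesis
    unfolding sum_subtractf 1 2 trapezoid_sum_def by (simp add: algebra_simps)
qed

section \<open>Lattice points counted slice by slice\<close>

definition slice_count :: int where
  "slice_count = (\<Sum>j\<in>{- H<..<H}. \<lceil>r j\<rceil> + \<lceil>r (- j)\<rceil> - 1)"

lemma slice_count_eq: "real_of_int slice_count = 2 * (\<Sum>j\<in>{- H<..<H}. real_of_int \<lceil>r j\<rceil>) - (2 * H - 1)"
  using sum_reflect[of "\<lambda>j. real_of_int \<lceil>r j\<rceil>"] H_pos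
  by (simp add: slice_count_def sum.distrib sum_subtractf)

lemma slice_count_crude: "trapezoid_sum - (r H + r (- H)) - (2 * H - 1) \<le> slice_count"
proof -
  have "(\<Sum>j\<in>{- H<..<H}. r j) \<le> (\<Sum>j\<in>{- H<..<H}. real_of_int \<lceil>r j\<rceil>)"
    by (intro sum_mono) simp
  then show ?thesis
    by (simp add: slice_count_eq trapezoid_sum_def)
qed

text \<open>Since the total defect is nonnegative, rounding up gains at least
  \<open>2 * H + (r H + r (- H)) - trapezoid_sum / H\<close> over the unrounded sum. In Pick's
  formula this corresponds to bounding the number of boundary points by \<open>2 / H\<close> times
  the area.\<close>

lemma slice_count_fine: "trapezoid_sum * (1 - 1 / H) + 1 \<le> slice_count"
proof -
  have "0 \<le> sum defect {- H..<H}"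
    using defect_nonneg[of "- H" H] ends_Ints H_pos by simp
  also have "sum defect {- H..<H} = 2 * (\<Sum>j\<in>{- H..<H}. \<lceil>r j\<rceil> - r j)
     + (trapezoid_sum - (r H + r (- H)) * H) / H - 2 * H"
    unfolding defect_def sum_cross[symmetric]
    using H_pos by (simp add: sum.distrib sum_subtractf sum_distrib_left[symmetric] sum_divide_distrib[symmetric])
  also have "{- H..<H} = insert (- H) {- H<..<H}"
    using H_pos by auto
  also have "(\<Sum>j\<in>insert (- H) {- H<..<H}. \<lceil>r j\<rceil> - r j) = (\<Sum>j\<in>{- H<..<H}. \<lceil>r j\<rceil> - r j)"
    using ends_Ints(2) by (auto elim!: Ints_cases)
  finally show ?thesis
    using H_pos unfolding slice_count_eq
    by (simp add: sum_subtractf trapezoid_sum_def field_simps)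
qed

text \<open>For \<open>r 0 < H\<close> the factors coincide and multiply to
  \<open>1 - 1 / H + 1 / (4 * H * H)\<close>. The last term contributes at most \<open>1\<close>,
  because the trapezoid sum is at most \<open>4 * H * H\<close>, and \<open>slice_count_fine\<close>
  has this \<open>1\<close> to spare. Otherwise \<open>crude_factor_bound\<close> applies with
  \<open>M = r 0\<close>.\<close>

lemma slice_count_bound:
  "trapezoid_sum * (1 - 1 / (2 * max (r 0) H)) * (1 - 1 / (2 * real_of_int H)) \<le> slice_count"
proof (cases "r 0 < H")
  case True
  define h where "h = real_of_int H"
  have h: "0 < h" "r 0 < h" using H_pos True by (auto simp: h_def)
  then have "4 * r 0 * h \<le> 4 * h * h"
    by (intro mult_right_mono) auto
  then have "trapezoid_sum \<le> 4 * h * h"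
    using trapezoid_sum_le by (simp add: h_def)
  then have "trapezoid_sum / (4 * h * h) \<le> 1"
    using h by (simp add: pos_divide_le_eq)
  moreover have "trapezoid_sum * (1 - 1 / (2 * h)) * (1 - 1 / (2 * h))
      = trapezoid_sum * (1 - 1 / h) + trapezoid_sum / (4 * h * h)"
    using h by (simp add: divide_simps) (simp add: algebra_simps)
  moreover have "max (r 0) H = h" using True by (simp add: h_def)
  ultimately show ?thesis
    using slice_count_fine unfolding h_def by linarith
next
  case False
  then have "max (r 0) H = r 0" by simp
  then show ?thesis
    using crude_factor_bound[of H "r 0" "r H + r (- H)" trapezoid_sum]
      False H_pos middle_ge trapezoid_sum_ge slice_count_crude
    by simp
qed

end

section \<open>Lattice polygons in the plane\<close>

lemma vector_2_eta [simp]: "(vector [p $ 1, p $ 2] :: real ^ 2) = p"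
  by (simp add: vec_eq_iff forall_2)

lemma vector_2_eq_iff: "p = q \<longleftrightarrow> p $ 1 = q $ 1 \<and> p $ 2 = q $ 2" for p q :: "real ^ 2"
  by (simp add: vec_eq_iff forall_2)

lemma integer_latticeE:
  assumes "p \<in> integer_lattice"
  obtains i j where "p $ 1 = real_of_int i" "p $ 2 = real_of_int j"
  using assms by (auto simp: integer_lattice_def) (metis Ints_cases)

lemma finite_integer_lattice_Int:
  assumes "bounded S"
  shows "finite (S \<inter> integer_lattice)"
proof -
  obtain B where B: "\<And>p. p \<in> S \<Longrightarrow> norm p \<le> B"
    using assms by (auto simp: bounded_iff)
  define I where "I = {- \<lceil>B\<rceil>..\<lceil>B\<rceil>}"
  have "S \<inter> integer_lattice \<subseteq> (\<lambda>(i, j). vector [real_of_int i, real_of_int j]) ` (I \<times> I)"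
  proof
    fix p assume p: "p \<in> S \<inter> integer_lattice"
    then obtain i j where ij: "p $ 1 = real_of_int i" "p $ 2 = real_of_int j"
      by (meson IntD2 integer_latticeE)
    have "\<bar>p $ 1\<bar> \<le> B" "\<bar>p $ 2\<bar> \<le> B"
      using B[of p] p component_le_norm_cart[of p 1] component_le_norm_cart[of p 2] by auto
    then have "i \<in> I" "j \<in> I"
      unfolding I_def ij by (auto simp: abs_le_iff) linarith+
    then show "p \<in> (\<lambda>(i, j). vector [real_of_int i, real_of_int j]) ` (I \<times> I)"
      using ij by (intro image_eqI[of _ _ "(i, j)"]) (auto simp: vector_2_eq_iff)
  qed
  then show ?thesis
    by (rule finite_subset) (simp add: I_def)
qed

text \<open>The hull of a union is the join of the two hulls; the first two cases serve when one of
  the sets is empty.\<close>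

lemma convex_hull_Un_cases:
  fixes A B :: "'a::euclidean_space set"
  assumes "p \<in> convex hull (A \<union> B)"
  obtains "p \<in> convex hull A" | "p \<in> convex hull B"
  | a b t where "a \<in> convex hull A" "b \<in> convex hull B" "0 \<le> t" "t \<le> 1" "p = (1 - t) *\<^sub>R a + t *\<^sub>R b"
proof (cases "A = {} \<or> B = {}")
  case True
  then show ?thesis using assms that(1,2) by auto
next
  case False
  have "convex hull (A \<union> B) = convex hull (convex hull A \<union> convex hull B)"
    by (metis hull_Un_left hull_Un_right)
  also have "\<dots> = {u *\<^sub>R s + v *\<^sub>R t |u v s t. u \<ge> 0 \<and> v \<ge> 0 \<and> u + v = 1 \<and> s \<in> convex hull A \<and> t \<in> convex hull B}"
    using False by (intro convex_hull_union_two) auto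
  finally obtain u v a b where "u \<ge> 0" "v \<ge> 0" "u + v = 1" "a \<in> convex hull A" "b \<in> convex hull B"
    "p = u *\<^sub>R a + v *\<^sub>R b"
    using assms by auto
  moreover from this have "u = 1 - v" by simp
  ultimately show ?thesis using that(3)[of a b v] by simp
qed

text \<open>The vector is the point at height \<open>y\<close> on the segment from \<open>a\<close>
  to \<open>b\<close>. Written through the slope, it yields lower bounds for the ends of
  slices.\<close>

lemma convex_chord:
  fixes P :: "(real ^ 2) set"
  assumes "convex P" "a \<in> P" "b \<in> P" "a $ 2 < b $ 2" "a $ 2 \<le> y" "y \<le> b $ 2"
  shows "vector [a $ 1 + (y - a $ 2) * ((b $ 1 - a $ 1) / (b $ 2 - a $ 2)), y] \<in> P"
proof -
  define t where "t = (y - a $ 2) / (b $ 2 - a $ 2)"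
  have t: "0 \<le> t" "t \<le> 1" using assms by (auto simp: t_def)
  have "(1 - t) *\<^sub>R a + t *\<^sub>R b \<in> P"
    using assms t by (intro convexD) auto
  moreover have "(1 - t) *\<^sub>R a + t *\<^sub>R b = vector [a $ 1 + t * (b $ 1 - a $ 1), a $ 2 + t * (b $ 2 - a $ 2)]"
    by (simp add: vector_2_eq_iff algebra_simps)
  moreover have "t * (b $ 2 - a $ 2) = y - a $ 2"
    "t * (b $ 1 - a $ 1) = (y - a $ 2) * ((b $ 1 - a $ 1) / (b $ 2 - a $ 2))"
    using assms(4) by (simp_all add: t_def)
  ultimately show ?thesis by simp
qed

lemma convex_combination_on_chord:
  fixes a b :: "real ^ 2"
  assumes "p = (1 - t) *\<^sub>R a + t *\<^sub>R b" "a $ 2 < b $ 2"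
  shows "p $ 1 = a $ 1 + (p $ 2 - a $ 2) * ((b $ 1 - a $ 1) / (b $ 2 - a $ 2))"
proof -
  have "p $ 2 - a $ 2 = t * (b $ 2 - a $ 2)"
    by (simp add: assms(1) algebra_simps)
  then have "(p $ 2 - a $ 2) * ((b $ 1 - a $ 1) / (b $ 2 - a $ 2)) = t * (b $ 1 - a $ 1)"
    using assms(2) by simp
  moreover have "p $ 1 = a $ 1 + t * (b $ 1 - a $ 1)"
    by (simp add: assms(1) algebra_simps)
  ultimately show ?thesis by simp
qed

lemma convex_halfspace_component:
  fixes c :: real
  shows "convex {v :: real ^ 'n. v $ i \<le> c}" "convex {v :: real ^ 'n. c \<le> v $ i}"
  using convex_halfspace_le[of "axis i 1 :: real ^ 'n" c] convex_halfspace_ge[of c "axis i 1 :: real ^ 'n"]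
  by (simp_all add: inner_axis' inner_real_def)

text \<open>At parameter \<open>t\<close> on the way from base to apex, the slice of the triangle is
  the interval from \<open>(1 - t) * l + t * d\<close> to \<open>(1 - t) * u + t * d\<close>. The
  apex may lie above or below the base.\<close>

lemma triangle_horizontal_base:
  fixes x y l u d h k :: real
  assumes "0 \<le> t" "t \<le> 1" "l \<le> u" "(1 - t) * l + t * d \<le> x" "x \<le> (1 - t) * u + t * d"
    and y: "y = (1 - t) * h + t * k"
  shows "(vector [x, y] :: real ^ 2) \<in> convex hull {vector [l, h], vector [u, h], vector [d, k]}"
proof -
  obtain a where a: "0 \<le> a" "a \<le> 1" "x = (1 - t) * ((1 - a) * l + a * u) + t * d"
  \<comment> \<open>The witness is the relative position of \<open>x\<close> in the slice; for a
    slice of length \<open>0\<close> the value \<open>0\<close> is taken.\<close>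
  proof (cases "(1 - t) * (u - l) = 0")
    case True
    then have "x = (1 - t) * ((1 - 0) * l + 0 * u) + t * d"
      using assms by (auto simp: algebra_simps)
    then show ?thesis using that[of 0] by simp
  next
    case False
    define a where "a = (x - (1 - t) * l - t * d) / ((1 - t) * (u - l))"
    have pos: "0 < (1 - t) * (u - l)"
      using False assms by (simp add: less_le)
    have "0 \<le> a" "a \<le> 1"
      using pos assms by (auto simp: a_def algebra_simps)
    moreover have "a * ((1 - t) * (u - l)) = x - (1 - t) * l - t * d"
      using False by (simp add: a_def)
    ultimately show ?thesis using that[of a] by (simp add: algebra_simps)
  qed
  have "(vector [x, y] :: real ^ 2) = ((1 - t) * (1 - a)) *\<^sub>R vector [l, h] + ((1 - t) * a) *\<^sub>R vector [u, h] + t *\<^sub>R vector [d, k]"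
    using a y by (simp add: vector_2_eq_iff algebra_simps)
  moreover have "0 \<le> (1 - t) * (1 - a)" "0 \<le> (1 - t) * a" "(1 - t) * (1 - a) + (1 - t) * a + t = 1"
    using a assms(2) mult_nonneg_nonneg[of "1 - t" "1 - a"] mult_nonneg_nonneg[of "1 - t" a]
    by (simp_all add: algebra_simps)
  ultimately show ?thesis
    unfolding convex_hull_3 using assms(1) by blast
qed

text \<open>The situation after the change of coordinates: the height has maximum \<open>H\<close>
  on \<open>P\<close>, and by \<open>width_V\<close> no nonzero integer functional has a smaller
  maximum.\<close>

locale wide_polygon =
  fixes V P :: "(real ^ 2) set" and H :: int
  assumes finite_V: "finite V"
    and lattice_V: "V \<subseteq> integer_lattice"
    and P_def: "P = convex hull V"
    and sym: "p \<in> P \<Longrightarrow> - p \<in> P"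
    and H_pos: "0 < H"
    and height: "p \<in> P \<Longrightarrow> p $ 2 \<le> H"
    and height_attained: "\<exists>p\<in>P. p $ 2 = H"
    and width_V: "a \<noteq> 0 \<or> b \<noteq> 0 \<Longrightarrow> \<exists>v\<in>V. real_of_int H \<le> real_of_int a * v $ 1 + real_of_int b * v $ 2"
begin

section \<open>Slices of the polygon at integer heights\<close>

lemma V_subset: "V \<subseteq> P"
  by (simp add: P_def hull_subset)

lemma convex_P: "convex P"
  by (simp add: P_def)

lemma compact_P: "compact P"
  by (simp add: P_def finite_V finite_imp_compact_convex_hull)

lemma height': "p \<in> P \<Longrightarrow> - H \<le> p $ 2"
  using height[OF sym, of p] by simp

lemma V_coords:
  assumes "v \<in> V"
  obtains k j :: int where "v $ 1 = k" "v $ 2 = j" "- H \<le> j" "j \<le> H"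
proof -
  obtain k j :: int where "v $ 1 = k" "v $ 2 = j"
    using assms lattice_V integer_latticeE by (meson subsetD)
  moreover have "- H \<le> j" "j \<le> H"
    using height[of v] height'[of v] assms V_subset \<open>v $ 2 = j\<close> by auto
  ultimately show ?thesis by (rule that)
qed

definition right_end :: "int \<Rightarrow> real" where
  "right_end j = (SOME x. vector [x, real_of_int j] \<in> P \<and> (\<forall>y. vector [y, real_of_int j] \<in> P \<longrightarrow> y \<le> x))"

text \<open>A point \<open>p\<close> of height \<open>H\<close> and its reflection
  \<open>- p\<close> span a segment that crosses every height in between, so the slice is nonempty,
  and compactness gives a rightmost point.\<close>

lemma right_end:
  assumes "- H \<le> j" "j \<le> H"
  shows "vector [right_end j, real_of_int j] \<in> P" "\<And>y. vector [y, real_of_int j] \<in> P \<Longrightarrow> y \<le> right_end j"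
proof -
  obtain p where p: "p \<in> P" "p $ 2 = H"
    using height_attained by blast
  have "vector [(- p) $ 1 + (j - (- p) $ 2) * ((p $ 1 - (- p) $ 1) / (p $ 2 - (- p) $ 2)), real_of_int j] \<in> P"
    using assms p sym[of p] H_pos by (intro convex_chord[OF convex_P]) auto
  then have "{p \<in> P. p $ 2 = j} \<noteq> {}"
    by fastforce
  moreover have "{p \<in> P. p $ 2 = j} = P \<inter> {p. p $ 2 = j}"
    by auto
  moreover have "closed {p :: real ^ 2. p $ 2 = j}"
    by (intro closed_Collect_eq continuous_intros)
  ultimately obtain q where q: "q \<in> P" "q $ 2 = j" "\<And>p. p \<in> P \<Longrightarrow> p $ 2 = j \<Longrightarrow> p $ 1 \<le> q $ 1"
    using continuous_attains_sup[of "{p \<in> P. p $ 2 = j}" "\<lambda>p. p $ 1"] compact_P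
    by (simp add: compact_Int_closed continuous_intros) blast
  have "\<exists>x. vector [x, real_of_int j] \<in> P \<and> (\<forall>y. vector [y, real_of_int j] \<in> P \<longrightarrow> y \<le> x)"
  proof (intro exI[of _ "q $ 1"] conjI allI impI)
    show "vector [q $ 1, real_of_int j] \<in> P"
      using q(1) unfolding q(2)[symmetric] by simp
    show "y \<le> q $ 1" if "vector [y, real_of_int j] \<in> P" for y
      using q(3)[OF that] by simp
  qed
  from someI_ex[OF this] show "vector [right_end j, real_of_int j] \<in> P" "\<And>y. vector [y, real_of_int j] \<in> P \<Longrightarrow> y \<le> right_end j"
    unfolding right_end_def by auto
qed

lemma right_end_ge:
  assumes "p \<in> P" "p $ 2 = real_of_int j"
  shows "p $ 1 \<le> right_end j"
proof -
  have "- H \<le> j" "j \<le> H"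
    using height[of p] height'[of p] assms by auto
  then show ?thesis
    using right_end(2)[of j "p $ 1"] assms by (metis vector_2_eta)
qed

lemma left_end_le:
  assumes "p \<in> P" "p $ 2 = real_of_int j"
  shows "- right_end (- j) \<le> p $ 1"
  using right_end_ge[OF sym[OF assms(1)], of "- j"] assms(2) by simp

lemma left_end:
  assumes "- H \<le> j" "j \<le> H"
  shows "vector [- right_end (- j), real_of_int j] \<in> P"
proof -
  have "- vector [right_end (- j), real_of_int (- j)] \<in> P"
    using right_end(1)[of "- j"] sym assms by auto
  moreover have "- vector [right_end (- j), real_of_int (- j)] = (vector [- right_end (- j), real_of_int j] :: real ^ 2)"
    by (simp add: vector_2_eq_iff)
  ultimately show ?thesis by simp
qed

lemma ends_le:
  assumes "- H \<le> j" "j \<le> H"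
  shows "0 \<le> right_end j + right_end (- j)"
  using left_end_le[OF right_end(1)[OF assms], of j] by simp

lemma convex_hull_height:
  assumes "W \<subseteq> V"
  shows "convex hull W \<subseteq> P"
    and "(\<And>v. v \<in> W \<Longrightarrow> v $ 2 \<le> c) \<Longrightarrow> p \<in> convex hull W \<Longrightarrow> p $ 2 \<le> c"
    and "(\<And>v. v \<in> W \<Longrightarrow> c \<le> v $ 2) \<Longrightarrow> p \<in> convex hull W \<Longrightarrow> c \<le> p $ 2"
    and "(\<And>v. v \<in> W \<Longrightarrow> v $ 1 \<le> c) \<Longrightarrow> p \<in> convex hull W \<Longrightarrow> p $ 1 \<le> c"
proof -
  show "convex hull W \<subseteq> P"
    unfolding P_def by (rule hull_mono[OF assms])
  show "p $ 2 \<le> c" if "\<And>v. v \<in> W \<Longrightarrow> v $ 2 \<le> c" "p \<in> convex hull W"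
  proof -
    have "convex hull W \<subseteq> {v. v $ 2 \<le> c}"
      using that(1) convex_halfspace_component by (intro hull_minimal) auto
    then show ?thesis using that(2) by auto
  qed
  show "c \<le> p $ 2" if "\<And>v. v \<in> W \<Longrightarrow> c \<le> v $ 2" "p \<in> convex hull W"
  proof -
    have "convex hull W \<subseteq> {v. c \<le> v $ 2}"
      using that(1) convex_halfspace_component by (intro hull_minimal) auto
    then show ?thesis using that(2) by auto
  qed
  show "p $ 1 \<le> c" if "\<And>v. v \<in> W \<Longrightarrow> v $ 1 \<le> c" "p \<in> convex hull W"
  proof -
    have "convex hull W \<subseteq> {v. v $ 1 \<le> c}"
      using that(1) convex_halfspace_component by (intro hull_minimal) auto
    then show ?thesis using that(2) by auto
  qed
qed

text \<open>No vertex lies strictly between two consecutive integer heights. Hence \<open>p\<close>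
  is on a segment from the hull of the vertices up to height \<open>j\<close> to the hull of those
  from height \<open>j + 1\<close> on, and the right ends bound this segment at both
  heights.\<close>

lemma right_end_between:
  assumes j: "- H \<le> j" "j < H" and p: "p \<in> P" "real_of_int j \<le> p $ 2" "p $ 2 \<le> real_of_int j + 1"
  shows "p $ 1 \<le> (1 - (p $ 2 - j)) * right_end j + (p $ 2 - j) * right_end (j + 1)"
proof -
  define A where "A = {v \<in> V. v $ 2 \<le> real_of_int j}"
  define B where "B = {v \<in> V. real_of_int j + 1 \<le> v $ 2}"
  have sub: "A \<subseteq> V" "B \<subseteq> V" by (auto simp: A_def B_def)
  have "V = A \<union> B"
  proof
    show "V \<subseteq> A \<union> B"
    proof
      fix v assume "v \<in> V"
      then obtain i :: int where "v $ 2 = i" by (rule V_coords)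
      then show "v \<in> A \<union> B"
        using \<open>v \<in> V\<close> by (cases "i \<le> j") (auto simp: A_def B_def)
    qed
  qed (use sub in auto)
  then have "p \<in> convex hull (A \<union> B)" using p P_def by simp
  then show ?thesis
  proof (cases rule: convex_hull_Un_cases)
    case 1
    then have "p $ 2 = j"
      using convex_hull_height(2)[OF sub(1), of j p] p by (auto simp: A_def)
    then show ?thesis using right_end_ge[OF p(1), of j] by simp
  next
    case 2
    then have "p $ 2 = j + 1"
      using convex_hull_height(3)[OF sub(2), of "real_of_int j + 1" p] p by (auto simp: B_def)
    then show ?thesis using right_end_ge[OF p(1), of "j + 1"] by simp
  next
    case (3 a b t)
    have ab: "a \<in> P" "b \<in> P" "a $ 2 \<le> j" "real_of_int j + 1 \<le> b $ 2"
      using 3 convex_hull_height(1)[OF sub(1)] convex_hull_height(1)[OF sub(2)]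
        convex_hull_height(2)[OF sub(1), of j a] convex_hull_height(3)[OF sub(2), of "real_of_int j + 1" b]
      by (auto simp: A_def B_def)
    define m where "m = (b $ 1 - a $ 1) / (b $ 2 - a $ 2)"
    have "p $ 1 = a $ 1 + (p $ 2 - a $ 2) * m"
      unfolding m_def using 3 ab by (intro convex_combination_on_chord[of _ t]) auto
    moreover have "a $ 1 + (j - a $ 2) * m \<le> right_end j"
      using right_end_ge[OF convex_chord[OF convex_P ab(1,2), of j], of j] ab by (simp add: m_def)
    moreover have "a $ 1 + (j + 1 - a $ 2) * m \<le> right_end (j + 1)"
      using right_end_ge[OF convex_chord[OF convex_P ab(1,2), of "j + 1"], of "j + 1"] ab by (simp add: m_def)
    ultimately have "(1 - (p $ 2 - j)) * (a $ 1 + (j - a $ 2) * m) \<le> (1 - (p $ 2 - j)) * right_end j"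
        "(p $ 2 - j) * (a $ 1 + (j + 1 - a $ 2) * m) \<le> (p $ 2 - j) * right_end (j + 1)"
        "p $ 1 = a $ 1 + (p $ 2 - a $ 2) * m"
      using p by (auto intro!: mult_left_mono)
    moreover have "a $ 1 + (p $ 2 - a $ 2) * m =
        (1 - (p $ 2 - j)) * (a $ 1 + (j - a $ 2) * m) + (p $ 2 - j) * (a $ 1 + (j + 1 - a $ 2) * m)"
      by (simp add: algebra_simps)
    ultimately show ?thesis
      by linarith
  qed
qed

text \<open>A right end that is not a lattice point is no vertex, so it is a combination of vertices
  strictly above and strictly below; these are at least one unit away, as their heights are
  integers.\<close>

lemma nonlattice_end_cases:
  assumes j: "- H \<le> j" "j \<le> H" and nonint: "right_end j \<notin> \<int>"
  obtains a b t where "a \<in> P" "b \<in> P" "a $ 2 \<le> real_of_int j - 1" "real_of_int j + 1 \<le> b $ 2"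
    "vector [right_end j, real_of_int j] = (1 - t) *\<^sub>R a + t *\<^sub>R b"
proof -
  define z :: "real ^ 2" where "z = vector [right_end j, real_of_int j]"
  have z: "z \<in> P" "z $ 1 = right_end j" "z $ 2 = j"
    using right_end(1)[OF j] by (auto simp: z_def)
  define A where "A = {v \<in> V. v $ 2 \<le> real_of_int j - 1}"
  define B where "B = {v \<in> V. real_of_int j + 1 \<le> v $ 2}"
  define C where "C = {v \<in> V. v $ 2 = real_of_int j}"
  define c where "c = real_of_int \<lfloor>right_end j\<rfloor>"
  have sub: "A \<subseteq> V" "B \<subseteq> V" "C \<subseteq> V" "A \<union> B \<subseteq> V" by (auto simp: A_def B_def C_def)
  have c: "c < right_end j"
    using nonint unfolding c_def by (metis Ints_of_int floor_correct less_le)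
  have V_Un: "V = (A \<union> B) \<union> C"
  proof
    show "V \<subseteq> (A \<union> B) \<union> C"
    proof
      fix v assume "v \<in> V"
      then obtain i :: int where "v $ 2 = i" by (rule V_coords)
      then show "v \<in> (A \<union> B) \<union> C"
        using \<open>v \<in> V\<close> by (cases i j rule: linorder_cases) (auto simp: A_def B_def C_def)
    qed
  qed (use sub in auto)
  have C: "p $ 1 \<le> c" "p $ 2 = j" if "p \<in> convex hull C" for p
  proof -
    have "v $ 1 \<le> c" if "v \<in> C" for v
    proof -
      have "v \<in> V" "v $ 2 = j" using that by (auto simp: C_def)
      then obtain k :: int where k: "v $ 1 = k" by (metis V_coords)
      then have "k \<le> right_end j"
        using right_end_ge[of v j] \<open>v \<in> V\<close> \<open>v $ 2 = j\<close> V_subset by auto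
      then show ?thesis unfolding k c_def by (simp add: le_floor_iff)
    qed
    then show "p $ 1 \<le> c" using convex_hull_height(4)[OF sub(3) _ that] by blast
    show "p $ 2 = j"
      using convex_hull_height(2)[OF sub(3) _ that, of j] convex_hull_height(3)[OF sub(3) _ that, of j]
      by (force simp: C_def)
  qed
  have "z \<in> convex hull ((A \<union> B) \<union> C)" using z P_def V_Un by simp
  then have "z \<in> convex hull (A \<union> B)"
  proof (cases rule: convex_hull_Un_cases)
    case 2
    then show ?thesis using C(1)[of z] z c by simp
  next
    \<comment> \<open>The point \<open>m\<close> comes from vertices of height \<open>j\<close>,
      whose integer first coordinates are at most \<open>c\<close>. Then \<open>w\<close> has height
      \<open>j\<close> as well, and any weight on \<open>m\<close> would move the combination
      strictly to the left of the end; so \<open>t = 0\<close>.\<close>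
    case (3 w m t)
    have t1: "t \<noteq> 1"
      using 3 C(1)[of m] z c by auto
    have "w \<in> P" using 3 convex_hull_height(1)[OF sub(4)] by auto
    have "(1 - t) * (w $ 2 - j) = 0"
      using z(3) C(2)[OF 3(2)] unfolding 3(5) by (simp add: algebra_simps)
    then have "w $ 2 = j" using t1 by simp
    then have "w $ 1 \<le> right_end j"
      using right_end_ge \<open>w \<in> P\<close> by simp
    then have "(1 - t) * w $ 1 \<le> (1 - t) * right_end j"
      using 3 by (intro mult_left_mono) auto
    moreover have "right_end j = (1 - t) * w $ 1 + t * m $ 1"
      using z(2) unfolding 3(5) by simp
    moreover have "t * m $ 1 \<le> t * c"
      using 3 C(1)[of m] by (intro mult_left_mono) auto
    ultimately have "right_end j \<le> (1 - t) * right_end j + t * c"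
      by linarith
    then have "t * (right_end j - c) \<le> 0"
      by (simp add: algebra_simps)
    then have "t = 0"
      using c 3(3) by (simp add: mult_le_0_iff)
    then show ?thesis using 3 by simp
  qed auto
  then show ?thesis
  proof (cases rule: convex_hull_Un_cases)
    case 1
    then show ?thesis
      using convex_hull_height(2)[OF sub(1), of "real_of_int j - 1" z] z by (auto simp: A_def)
  next
    case 2
    then show ?thesis
      using convex_hull_height(3)[OF sub(2), of "real_of_int j + 1" z] z by (auto simp: B_def)
  next
    case (3 a b t)
    have "a \<in> P" "b \<in> P" "a $ 2 \<le> real_of_int j - 1" "real_of_int j + 1 \<le> b $ 2"
      using 3 convex_hull_height(1)[OF sub(1)] convex_hull_height(1)[OF sub(2)]
        convex_hull_height(2)[OF sub(1), of "real_of_int j - 1" a]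
        convex_hull_height(3)[OF sub(2), of "real_of_int j + 1" b]
      by (auto simp: A_def B_def)
    moreover have "vector [right_end j, real_of_int j] = (1 - t) *\<^sub>R a + t *\<^sub>R b"
      using 3(5) by (simp add: z_def)
    ultimately show ?thesis by (rule that)
  qed
qed

text \<open>Concavity is convexity of \<open>P\<close> along chords. A non-integer end lies on a
  chord reaching one unit up and down, which gives \<open>no_vertex\<close>; at heights
  \<open>H\<close> and \<open>- H\<close> such a chord would leave \<open>P\<close>, so the ends
  there are integers. The width condition is \<open>width_V\<close> for the functional
  \<open>(q, - p)\<close>.\<close>

sublocale boundary_profile right_end H
proof
  show "0 < H" by (rule H_pos)
next
  fix i j k assume ijk: "- H \<le> i" "i < j" "j < k" "k \<le> H"
  have "right_end i + (j - i) * ((right_end k - right_end i) / (k - i)) \<le> right_end j"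
    using right_end_ge[OF convex_chord[OF convex_P right_end(1)[of i] right_end(1)[of k], of j], of j] ijk
    by simp
  then have "right_end i + (j - i) * (right_end k - right_end i) / (k - i) \<le> right_end j"
    by simp
  then have "(right_end i + (j - i) * (right_end k - right_end i) / (k - i)) * (k - i) \<le> right_end j * (k - i)"
    using ijk by (intro mult_right_mono) auto
  moreover have "(right_end i + (j - i) * (right_end k - right_end i) / (k - i)) * (k - i)
      = right_end i * (k - i) + (j - i) * (right_end k - right_end i)"
    using ijk by (simp add: distrib_right)
  ultimately show "real_of_int (k - j) * right_end i + real_of_int (j - i) * right_end k
      \<le> real_of_int (k - i) * right_end j"
    by (simp add: algebra_simps)
next
  fix j assume j: "- H < j" "j < H" "right_end j \<notin> \<int>"
  then obtain a b t where ab: "a \<in> P" "b \<in> P" "a $ 2 \<le> real_of_int j - 1" "real_of_int j + 1 \<le> b $ 2"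
    "vector [right_end j, real_of_int j] = (1 - t) *\<^sub>R a + t *\<^sub>R b"
    using nonlattice_end_cases[of j] by auto
  define m where "m = (b $ 1 - a $ 1) / (b $ 2 - a $ 2)"
  have "right_end j = a $ 1 + (j - a $ 2) * m"
    using convex_combination_on_chord[OF ab(5)] ab(3,4) by (simp add: m_def)
  moreover have "a $ 1 + (j - 1 - a $ 2) * m \<le> right_end (j - 1)"
    using right_end_ge[OF convex_chord[OF convex_P ab(1,2), of "j - 1"], of "j - 1"] ab by (simp add: m_def)
  moreover have "a $ 1 + (j + 1 - a $ 2) * m \<le> right_end (j + 1)"
    using right_end_ge[OF convex_chord[OF convex_P ab(1,2), of "j + 1"], of "j + 1"] ab by (simp add: m_def)
  ultimately show "2 * right_end j \<le> right_end (j - 1) + right_end (j + 1)"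
    by (simp add: algebra_simps)
next
  show "right_end H \<in> \<int>"
  proof (rule ccontr)
    assume "right_end H \<notin> \<int>"
    then obtain b where "b \<in> P" "real_of_int H + 1 \<le> b $ 2"
      using nonlattice_end_cases[of H] H_pos by auto
    then show False using height[of b] by simp
  qed
  show "right_end (- H) \<in> \<int>"
  proof (rule ccontr)
    assume "right_end (- H) \<notin> \<int>"
    then obtain a where "a \<in> P" "a $ 2 \<le> real_of_int (- H) - 1"
      using nonlattice_end_cases[of "- H"] H_pos by auto
    then show False using height'[of a] by simp
  qed
next
  fix p q :: int assume q: "0 < q"
  then obtain v where v: "v \<in> V" "real_of_int H \<le> real_of_int q * v $ 1 + real_of_int (- p) * v $ 2"
    using width_V[of q "- p"] by auto
  obtain i where i: "v $ 2 = real_of_int i" "- H \<le> i" "i \<le> H"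
    using V_coords[OF v(1)] by metis
  have "real_of_int q * v $ 1 \<le> real_of_int q * right_end i"
    using right_end_ge[of v i] v i V_subset q by (intro mult_left_mono) auto
  then show "\<exists>i\<ge>- H. i \<le> H \<and> real_of_int H \<le> real_of_int q * right_end i - real_of_int p * real_of_int i"
    using v i by (intro exI[of _ i]) auto
qed

section \<open>Upper bound for the area\<close>

definition lower_triangle :: "int \<Rightarrow> (real ^ 2) set" where
  "lower_triangle j = convex hull {vector [- right_end (- j), real_of_int j], vector [right_end j, real_of_int j],
     vector [right_end (j + 1), real_of_int j + 1]}"

definition upper_triangle :: "int \<Rightarrow> (real ^ 2) set" where
  "upper_triangle j = convex hull {vector [- right_end (- (j + 1)), real_of_int j + 1],
     vector [right_end (j + 1), real_of_int j + 1], vector [- right_end (- j), real_of_int j]}"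

lemma measure_triangles:
  assumes "- H \<le> j" "j < H"
  shows "measure lborel (lower_triangle j) = (right_end j + right_end (- j)) / 2"
    and "measure lborel (upper_triangle j) = (right_end (j + 1) + right_end (- (j + 1))) / 2"
  using ends_le[of j] ends_le[of "j + 1"] assms
  by (simp_all add: lower_triangle_def upper_triangle_def content_triangle)

text \<open>Between consecutive integer heights \<open>P\<close> lies in a trapezoid, which the
  diagonal from the lower left to the upper right corner cuts into the two triangles.\<close>

lemma strip_subset:
  assumes j: "- H \<le> j" "j < H" and p: "p \<in> P" "real_of_int j \<le> p $ 2" "p $ 2 \<le> real_of_int j + 1"
  shows "p \<in> lower_triangle j \<union> upper_triangle j"
proof -
  define t where "t = p $ 2 - j"
  have t: "0 \<le> t" "t \<le> 1" using p by (auto simp: t_def)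
  have right: "p $ 1 \<le> (1 - t) * right_end j + t * right_end (j + 1)"
    using right_end_between[OF j p] by (simp add: t_def)
  \<comment> \<open>This is the bound on the right applied to \<open>- p\<close>, which lies in the
    strip from \<open>- (j + 1)\<close> to \<open>- j\<close>.\<close>
  have left: "(1 - t) * - right_end (- j) + t * - right_end (- (j + 1)) \<le> p $ 1"
    using right_end_between[of "- (j + 1)" "- p"] j p sym[OF p(1)] by (simp add: t_def algebra_simps)
  show ?thesis
  \<comment> \<open>The cases are the two sides of the diagonal. The upper triangle has its base at
    the top, hence the parameter \<open>1 - t\<close> there.\<close>
  proof (cases "(1 - t) * - right_end (- j) + t * right_end (j + 1) \<le> p $ 1")
    case True
    then have "vector [p $ 1, p $ 2] \<in> lower_triangle j"
      unfolding lower_triangle_def using t right ends_le[of j] j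
      by (intro triangle_horizontal_base[of t]) (auto simp: t_def algebra_simps)
    then show ?thesis by simp
  next
    case False
    then have "vector [p $ 1, p $ 2] \<in> upper_triangle j"
      unfolding upper_triangle_def using t left ends_le[of "j + 1"] j
      by (intro triangle_horizontal_base[of "1 - t"]) (auto simp: t_def algebra_simps)
    then show ?thesis by simp
  qed
qed

text \<open>The triangles cover \<open>P\<close>, so their areas bound its area. Each inner height
  carries the base of one lower and one upper triangle, the heights \<open>- H\<close> and
  \<open>H\<close> only one base each, which is the trapezoid rule.\<close>

lemma measure_le: "measure lebesgue P \<le> trapezoid_sum"
proof -
  have "P \<subseteq> (\<Union>j\<in>{- H..<H}. lower_triangle j \<union> upper_triangle j)"
  proof
    fix p assume p: "p \<in> P"
    \<comment> \<open>The minimum with \<open>H - 1\<close> puts the points of height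
      \<open>H\<close> into the last strip.\<close>
    define j where "j = min \<lfloor>p $ 2\<rfloor> (H - 1)"
    have "- H \<le> \<lfloor>p $ 2\<rfloor>"
      using height'[OF p] by (simp add: le_floor_iff)
    then have "j \<in> {- H..<H}"
      using H_pos by (auto simp: j_def)
    moreover have "real_of_int j \<le> p $ 2" "p $ 2 \<le> real_of_int j + 1"
      using height[OF p] by (auto simp: j_def min_def) linarith+
    ultimately show "p \<in> (\<Union>j\<in>{- H..<H}. lower_triangle j \<union> upper_triangle j)"
      using strip_subset[of j p] p by auto
  qed
  moreover have compact: "compact (lower_triangle j)" "compact (upper_triangle j)" for j
    by (simp_all add: lower_triangle_def upper_triangle_def finite_imp_compact_convex_hull)
  ultimately have "measure lebesgue P \<le> measure lebesgue (\<Union>j\<in>{- H..<H}. lower_triangle j \<union> upper_triangle j)"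
    using compact_P
    by (intro measure_mono_fmeasurable fmeasurableD lmeasurable_compact compact_UN compact_Un) auto
  also have "\<dots> \<le> (\<Sum>j\<in>{- H..<H}. measure lebesgue (lower_triangle j \<union> upper_triangle j))"
    using compact by (intro measure_UNION_le fmeasurableD lmeasurable_compact compact_Un) auto
  also have "\<dots> \<le> (\<Sum>j\<in>{- H..<H}. (right_end j + right_end (- j)) / 2 + (right_end (j + 1) + right_end (- (j + 1))) / 2)"
  proof (intro sum_mono)
    fix j assume j: "j \<in> {- H..<H}"
    have "measure lebesgue (lower_triangle j \<union> upper_triangle j)
        \<le> measure lebesgue (lower_triangle j) + measure lebesgue (upper_triangle j)"
      using compact by (intro measure_Un_le fmeasurableD lmeasurable_compact)
    also have "\<dots> = measure lborel (lower_triangle j) + measure lborel (upper_triangle j)"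
      using compact by (simp add: measure_completion compact_imp_closed borel_closed)
    finally show "measure lebesgue (lower_triangle j \<union> upper_triangle j)
        \<le> (right_end j + right_end (- j)) / 2 + (right_end (j + 1) + right_end (- (j + 1))) / 2"
      using measure_triangles[of j] j by (simp only: atLeastLessThan_iff)
  qed
  also have "\<dots> = trapezoid_sum"
  proof -
    define g where "g j = (right_end j + right_end (- j)) / 2" for j
    have "(\<Sum>j\<in>{- H..<H}. g (j + 1)) = (\<Sum>j\<in>{- H<..H}. g j)"
      by (rule sum.reindex_bij_witness[of _ "\<lambda>j. j - 1" "\<lambda>j. j + 1"]) auto
    also have "{- H<..H} = insert H {- H<..<H}"
      using H_pos by auto
    finally have 1: "(\<Sum>j\<in>{- H..<H}. g (j + 1)) = g H + (\<Sum>j\<in>{- H<..<H}. g j)"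
      by simp
    have "{- H..<H} = insert (- H) {- H<..<H}"
      using H_pos by auto
    then have 2: "(\<Sum>j\<in>{- H..<H}. g j) = g (- H) + (\<Sum>j\<in>{- H<..<H}. g j)"
      by simp
    have "(\<Sum>j\<in>{- H<..<H}. g j) = (\<Sum>j\<in>{- H<..<H}. right_end j)"
      using sum_reflect[of right_end] by (simp add: g_def sum_divide_distrib[symmetric] sum.distrib)
    moreover have "g (- H) + g H = right_end H + right_end (- H)"
      by (simp add: g_def field_simps)
    ultimately have "(\<Sum>j\<in>{- H..<H}. g j + g (j + 1)) = trapezoid_sum"
      unfolding sum.distrib 1 2 trapezoid_sum_def by linarith
    then show ?thesis by (simp add: g_def)
  qed
  finally show ?thesis .
qed

section \<open>Interior lattice points\<close>

lemma slice_interior: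
  assumes j: "- H < j" "j < H" and x: "- right_end (- j) < x" "x < right_end j"
  shows "vector [x, real_of_int j] \<in> interior P"
proof (rule ccontr)
  assume notin: "vector [x, real_of_int j] \<notin> interior P"
  define z :: "real ^ 2" where "z = vector [x, real_of_int j]"
  have l: "vector [- right_end (- j), real_of_int j] \<in> P" and r: "vector [right_end j, real_of_int j] \<in> P"
    using left_end[of j] right_end(1)[of j] j by auto
  have "z \<in> closed_segment (vector [- right_end (- j), real_of_int j]) (vector [right_end j, real_of_int j])"
  proof -
    define t where "t = (x + right_end (- j)) / (right_end j + right_end (- j))"
    have "0 \<le> t" "t \<le> 1" "t * (right_end j + right_end (- j)) = x + right_end (- j)"
      using x by (auto simp: t_def field_simps)
    then show ?thesis
      unfolding closed_segment_def z_def by (intro CollectI exI[of _ t]) (simp add: vector_2_eq_iff algebra_simps)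
  qed
  then have "z \<in> P"
    using closed_segment_subset[OF l r convex_P] by blast
  \<comment> \<open>If \<open>z\<close> is not interior, some nonzero functional attains its minimum
    over \<open>P\<close> at \<open>z\<close>. Since \<open>z\<close> lies strictly between the ends
    of its slice and strictly between the heights \<open>- H\<close> and \<open>H\<close>, both
    coordinates of this functional vanish.\<close>
  obtain a where a: "a \<noteq> 0" "\<And>p. p \<in> P \<Longrightarrow> a \<bullet> z \<le> a \<bullet> p"
  proof (cases "interior P = {}")
    case True
    \<comment> \<open>Here \<open>P\<close> lies on a line, and a normal of that line is constant on
      \<open>P\<close>.\<close>
    obtain a b where a: "a \<noteq> 0" "P \<subseteq> {p. a \<bullet> p = b}"
      by (rule empty_interior_subset_hyperplane[OF convex_P True])
    have "a \<bullet> z \<le> a \<bullet> p" if "p \<in> P" for p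
      using subsetD[OF a(2) \<open>z \<in> P\<close>] subsetD[OF a(2) \<open>p \<in> P\<close>] by simp
    then show ?thesis by (rule that[OF a(1)])
  next
    case False
    then have "z \<notin> rel_interior P"
      using notin by (simp add: rel_interior_nonempty_interior z_def)
    then show ?thesis
      by (rule supporting_hyperplane_rel_boundary[OF convex_P \<open>z \<in> P\<close>]) (rule that)
  qed
  have inner: "a \<bullet> p = a $ 1 * p $ 1 + a $ 2 * p $ 2" for p
    by (simp add: inner_vec_def sum_2)
  have "0 \<le> a $ 1 * (- right_end (- j) - x)" "0 \<le> a $ 1 * (right_end j - x)"
    using a(2)[OF l] a(2)[OF r] by (simp_all add: inner z_def algebra_simps)
  then have a1: "a $ 1 = 0"
    using x by (auto simp: zero_le_mult_iff)
  obtain q where "q \<in> P" "q $ 2 = H"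
    using height_attained by blast
  then have "0 \<le> a $ 2 * (H - j)" "0 \<le> a $ 2 * (- H - j)"
    using a(2)[of q] a(2)[OF sym, of q] by (simp_all add: inner z_def a1 algebra_simps)
  then have "a $ 2 = 0"
    using j by (auto simp: zero_le_mult_iff)
  then show False
    using a(1) a1 by (simp add: vector_2_eq_iff)
qed

text \<open>The integers strictly between \<open>- right_end (- j)\<close> and
  \<open>right_end j\<close> are exactly those in the interval used for \<open>S\<close>, and
  \<open>slice_interior\<close> makes them interior points.\<close>

lemma slice_count_le: "slice_count \<le> int (lattice_point_count (interior P))"
proof -
  define S where "S = Sigma {- H<..<H} (\<lambda>j. {- \<lceil>right_end (- j)\<rceil> + 1..\<lceil>right_end j\<rceil> - 1})"
  define g :: "int \<times> int \<Rightarrow> real ^ 2" where "g = (\<lambda>(j, k). vector [real_of_int k, real_of_int j])"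
  have inj: "inj_on g S"
    by (auto simp: inj_on_def g_def vector_2_eq_iff)
  have "g ` S \<subseteq> interior P \<inter> integer_lattice"
  proof
    fix p assume "p \<in> g ` S"
    then obtain j k where jk: "- H < j" "j < H" "- \<lceil>right_end (- j)\<rceil> + 1 \<le> k" "k \<le> \<lceil>right_end j\<rceil> - 1"
      "p = vector [real_of_int k, real_of_int j]"
      by (auto simp: S_def g_def)
    have "- right_end (- j) < k" "k < right_end j"
      using jk(3,4) by linarith+
    then show "p \<in> interior P \<inter> integer_lattice"
      using slice_interior[of j k] jk by (simp add: integer_lattice_def forall_2)
  qed
  moreover have "finite (interior P \<inter> integer_lattice)"
    using bounded_subset[OF compact_imp_bounded[OF compact_P] interior_subset]
    by (rule finite_integer_lattice_Int)
  ultimately have "card (g ` S) \<le> lattice_point_count (interior P)"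
    unfolding lattice_point_count_def by (intro card_mono)
  moreover have "card (g ` S) = (\<Sum>j\<in>{- H<..<H}. nat (\<lceil>right_end j\<rceil> + \<lceil>right_end (- j)\<rceil> - 1))"
    unfolding card_image[OF inj] unfolding S_def by (subst card_SigmaI) (auto intro!: sum.cong simp: algebra_simps)
  \<comment> \<open>Truncation by \<open>nat\<close> only raises the sum; a summand
    \<open>- 1\<close> would belong to a slice that is a single lattice point.\<close>
  moreover have "slice_count \<le> (\<Sum>j\<in>{- H<..<H}. int (nat (\<lceil>right_end j\<rceil> + \<lceil>right_end (- j)\<rceil> - 1)))"
    unfolding slice_count_def by (intro sum_mono) auto
  ultimately show ?thesis by (simp only: of_nat_sum[symmetric])
qed

lemma lattice_point_count_ge:
  "measure lebesgue P * (1 - 1 / (2 * max (right_end 0) H)) * (1 - 1 / (2 * real_of_int H))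
    \<le> lattice_point_count (interior P)"
proof -
  have "1 \<le> real_of_int H" using H_pos by simp
  then have "0 \<le> 1 - 1 / (2 * max (right_end 0) H)" "0 \<le> 1 - 1 / (2 * real_of_int H)"
    by (simp_all add: field_simps)
  then have "measure lebesgue P * (1 - 1 / (2 * max (right_end 0) H)) * (1 - 1 / (2 * real_of_int H))
      \<le> trapezoid_sum * (1 - 1 / (2 * max (right_end 0) H)) * (1 - 1 / (2 * real_of_int H))"
    by (intro mult_right_mono measure_le) auto
  also have "\<dots> \<le> slice_count" by (rule slice_count_bound)
  also have "real_of_int slice_count \<le> lattice_point_count (interior P)"
    using slice_count_le by linarith
  finally show ?thesis .
qed

end

section \<open>Successive minima and unimodular maps\<close>

text \<open>\<open>LEAST\<close> over the reals says something only once a minimum is exhibited. The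
  dimension hypothesis makes the factor \<open>1\<close> admissible, which also gives the upper
  bound.\<close>

lemma successive_minimum_attained:
  assumes "compact K" "convex K" "0 \<in> K" "1 \<le> i" and dim1: "i \<le> dim (K \<inter> integer_lattice)"
  shows "0 < successive_minimum i K" "successive_minimum i K \<le> 1"
    "i \<le> dim (((*\<^sub>R) (successive_minimum i K) ` K) \<inter> integer_lattice)"
proof -
  define L where "L l = ((*\<^sub>R) l ` K) \<inter> integer_lattice" for l
  have mono: "L l \<subseteq> L l'" if "0 < l" "l \<le> l'" for l l'
  proof -
    have "l *\<^sub>R k \<in> (*\<^sub>R) l' ` K" if "k \<in> K" for k
    proof -
      have "(1 - l / l') *\<^sub>R 0 + (l / l') *\<^sub>R k \<in> K"
        using assms \<open>0 < l\<close> \<open>l \<le> l'\<close> that by (intro convexD) auto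
      then show ?thesis
        using \<open>0 < l\<close> \<open>l \<le> l'\<close> by (intro image_eqI[of _ _ "(l / l') *\<^sub>R k"]) auto
    qed
    then show ?thesis by (auto simp: L_def)
  qed
  have fin: "finite (L l)" for l
    unfolding L_def using assms(1)
    by (intro finite_integer_lattice_Int bounded_scaling compact_imp_bounded)
  define Q where "Q l \<longleftrightarrow> 0 < l \<and> i \<le> dim (L l)" for l
  have "Q 1" using dim1 by (simp add: Q_def L_def)
  \<comment> \<open>With the lattice points of \<open>l K\<close> as few as possible, every smaller admissible dilate
    has the same lattice points \<open>W\<close>, so the minimum is the least dilate containing \<open>W\<close>.\<close>
  then obtain l where l: "Q l" "\<And>l'. Q l' \<Longrightarrow> card (L l) \<le> card (L l')"
    using ex_has_least_nat[of Q 1 "\<lambda>l. card (L l)"] by auto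
  then have "0 < l" by (simp add: Q_def)
  define W where "W = L l"
  have "\<not> W \<subseteq> {0}"
    using l(1) assms(4) iffD2[OF dim_eq_0, of W] unfolding Q_def W_def by linarith
  then obtain w where w: "w \<in> W" "w \<noteq> 0" by auto
  \<comment> \<open>\<open>C\<close> consists of the factors \<open>t\<close> that carry
    \<open>W\<close> into \<open>K\<close>, and a nonzero \<open>w\<close> in \<open>W\<close> makes
    it bounded. The reciprocal of its maximum is the least positive factor whose dilate of
    \<open>K\<close> contains \<open>W\<close>.\<close>
  define C where "C = (\<Inter>w\<in>W. (\<lambda>t. t *\<^sub>R w) -` K)"
  have "closed C"
    unfolding C_def using compact_imp_closed[OF assms(1)]
    by (intro closed_INT ballI closed_vimage continuous_intros)
  moreover obtain B where B: "\<And>p. p \<in> K \<Longrightarrow> norm p \<le> B"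
    using compact_imp_bounded[OF assms(1)] by (auto simp: bounded_iff)
  have "bounded C"
    unfolding bounded_iff
  proof (intro exI[of _ "B / norm w"] ballI)
    fix t assume "t \<in> C"
    then have "t *\<^sub>R w \<in> K" using w by (auto simp: C_def)
    then have "norm (t *\<^sub>R w) \<le> B" by (rule B)
    then show "norm t \<le> B / norm w" using w by (simp add: pos_le_divide_eq)
  qed
  ultimately have "compact C" by (simp add: compact_eq_bounded_closed)
  have inC: "1 / l' \<in> C" if "0 < l'" "W \<subseteq> L l'" for l'
    using that by (fastforce simp: C_def L_def)
  then have "1 / l \<in> C" using \<open>0 < l\<close> by (simp add: W_def)
  then obtain t where t: "t \<in> C" "\<And>s. s \<in> C \<Longrightarrow> s \<le> t"
    using compact_attains_sup[OF \<open>compact C\<close>] by blast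
  have "1 / l \<le> t" using t \<open>1 / l \<in> C\<close> by blast
  moreover have "0 < 1 / l" using \<open>0 < l\<close> by simp
  ultimately have "0 < t" by linarith
  have "W \<subseteq> L (1 / t)"
  proof
    fix v assume v: "v \<in> W"
    then have "t *\<^sub>R v \<in> K" using t(1) by (auto simp: C_def)
    then have "v \<in> (*\<^sub>R) (1 / t) ` K"
      using \<open>0 < t\<close> by (intro image_eqI[of _ _ "t *\<^sub>R v"]) auto
    then show "v \<in> L (1 / t)" using v by (auto simp: W_def L_def)
  qed
  then have "Q (1 / t)"
    using l(1) dim_subset[of W "L (1 / t)"] \<open>0 < t\<close> by (auto simp: Q_def W_def)
  moreover have least: "1 / t \<le> l'" if "Q l'" for l'
  proof (cases "l \<le> l'")
    case True
    have "1 / t \<le> l" using \<open>1 / l \<le> t\<close> \<open>0 < l\<close> \<open>0 < t\<close> by (simp add: field_simps)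
    then show ?thesis using True by simp
  next
    case False
    have "0 < l'" using that by (simp add: Q_def)
    then have "L l' \<subseteq> W" using mono False by (simp add: W_def)
    then have "W = L l'"
      using card_seteq[of W "L l'"] l(2)[OF that] fin by (simp add: W_def)
    then have "1 / l' \<le> t" using inC \<open>0 < l'\<close> t(2) by blast
    then show ?thesis using \<open>0 < l'\<close> \<open>0 < t\<close> by (simp add: field_simps)
  qed
  ultimately have "successive_minimum i K = 1 / t"
    unfolding successive_minimum_def Q_def L_def by (intro Least_equality) auto
  then show "0 < successive_minimum i K" "successive_minimum i K \<le> 1"
    "i \<le> dim (((*\<^sub>R) (successive_minimum i K) ` K) \<inter> integer_lattice)"
    using \<open>Q (1 / t)\<close> least[OF \<open>Q 1\<close>] by (auto simp: Q_def L_def)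
qed

lemma zero_in_interior:
  fixes P :: "'a::euclidean_space set"
  assumes "convex P" "uminus ` P = P" "interior P \<noteq> {}"
  shows "0 \<in> interior P"
proof -
  obtain x where x: "x \<in> interior P" using assms by blast
  then have "- x \<in> interior P"
    using interior_negations[of P] assms(2) by auto
  then have "(1 / 2) *\<^sub>R x + (1 / 2) *\<^sub>R (- x) \<in> interior P"
    using x assms(1) by (intro convexD[OF convex_interior]) auto
  then show ?thesis by simp
qed

locale unimodular =
  fixes a b c d :: int
  assumes det: "c * b - d * a = 1"
begin

text \<open>The functional \<open>(a, b)\<close> is placed second so that it becomes the height; the
  row \<open>(c, d)\<close> completes it to determinant \<open>1\<close>.\<close>

definition basis_map :: "real ^ 2 \<Rightarrow> real ^ 2" where
  "basis_map p = vector [c * p $ 1 + d * p $ 2, a * p $ 1 + b * p $ 2]"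

lemma basis_map_component [simp]: "basis_map p $ 1 = c * p $ 1 + d * p $ 2" "basis_map p $ 2 = a * p $ 1 + b * p $ 2"
  by (simp_all add: basis_map_def)

lemma real_det: "real_of_int c * b - real_of_int d * a = 1"
  using det by (metis of_int_1 of_int_diff of_int_mult)

text \<open>The coefficients form the inverse matrix, which is integral because the determinant is
  \<open>1\<close>.\<close>

lemma basis_map_solve:
  "p $ 1 = b * basis_map p $ 1 - d * basis_map p $ 2" "p $ 2 = c * basis_map p $ 2 - a * basis_map p $ 1"
proof -
  have "b * basis_map p $ 1 - d * basis_map p $ 2 = (real_of_int c * b - real_of_int d * a) * p $ 1"
    "c * basis_map p $ 2 - a * basis_map p $ 1 = (real_of_int c * b - real_of_int d * a) * p $ 2"
    by (simp_all add: algebra_simps)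
  then show "p $ 1 = b * basis_map p $ 1 - d * basis_map p $ 2" "p $ 2 = c * basis_map p $ 2 - a * basis_map p $ 1"
    by (simp_all add: real_det)
qed

lemma linear_basis_map: "linear basis_map"
  by (rule linearI) (simp_all add: vector_2_eq_iff algebra_simps)

lemma inj_basis_map: "inj basis_map"
  by (rule injI) (metis basis_map_solve vector_2_eq_iff)

lemma basis_map_lattice_iff: "basis_map p \<in> integer_lattice \<longleftrightarrow> p \<in> integer_lattice"
proof
  assume "basis_map p \<in> integer_lattice"
  then show "p \<in> integer_lattice"
    using basis_map_solve[of p] unfolding integer_lattice_def forall_2 mem_Collect_eq
    by (metis Ints_diff Ints_mult Ints_of_int)
next
  assume "p \<in> integer_lattice"
  then show "basis_map p \<in> integer_lattice"
    by (simp add: integer_lattice_def forall_2)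
qed

lemma lattice_point_count_basis_map: "lattice_point_count (interior (basis_map ` P)) = lattice_point_count (interior P)"
proof -
  have "interior (basis_map ` P) \<inter> integer_lattice = basis_map ` (interior P \<inter> integer_lattice)"
    using interior_injective_linear_image[OF linear_basis_map inj_basis_map, of P] by (auto simp: basis_map_lattice_iff)
  then show ?thesis
    unfolding lattice_point_count_def
    using card_image[OF inj_on_subset[OF inj_basis_map subset_UNIV]] by metis
qed

lemma measure_basis_map:
  assumes "compact P"
  shows "measure lebesgue (basis_map ` P) = measure lebesgue P"
proof -
  have "det (matrix basis_map) = 1"
    using real_det by (simp add: det_2 matrix_def axis_def)
  then show ?thesis
    using measure_linear_image[OF linear_basis_map lmeasurable_compact[OF assms]] by simp
qed

end

section \<open>Choice of coordinates and comparison with the successive minima\<close>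

theorem proposition1p5:
  fixes P :: "(real ^ 2) set"
  assumes "P \<in> convex_bodies"
    and "origin_symmetric P"
    and "lattice_polygon P"
  shows "real (lattice_point_count (interior P)) \<ge>
    measure lebesgue P * (1 - successive_minimum 1 P / 2) * (1 - successive_minimum 2 P / 2)"
proof -
  have P: "compact P" "convex P" "interior P \<noteq> {}" "uminus ` P = P"
    using assms by (auto simp: convex_bodies_def origin_symmetric_def)
  obtain V where V: "finite V" "V \<subseteq> integer_lattice" "P = convex hull V"
    using assms by (auto simp: lattice_polygon_def)
  have "V \<noteq> {}" using P V by auto
  have "V \<subseteq> P" by (simp add: V hull_subset)
  have zero: "0 \<in> interior P" by (rule zero_in_interior[OF P(2,4,3)])
  define \<phi> :: "int \<times> int \<Rightarrow> real ^ 2 \<Rightarrow> real" where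
    "\<phi> = (\<lambda>(a, b) p. a * p $ 1 + b * p $ 2)"
  \<comment> \<open>This is the support function of \<open>P\<close> on integer functionals; as a
    maximum over lattice points it is integral.\<close>
  define h where "h u = Max (\<phi> u ` V)" for u
  have h_ge: "\<phi> u p \<le> h u" if "p \<in> P" for u p
  proof -
    have "\<phi> u p = vector [real_of_int (fst u), real_of_int (snd u)] \<bullet> p" for p
      by (simp add: \<phi>_def case_prod_beta inner_vec_def sum_2)
    then have "convex {p. \<phi> u p \<le> h u}"
      using convex_halfspace_le by simp
    moreover have "V \<subseteq> {p. \<phi> u p \<le> h u}"
      using V \<open>V \<noteq> {}\<close> by (auto simp: h_def)
    ultimately have "P \<subseteq> {p. \<phi> u p \<le> h u}"
      unfolding V(3) by (intro hull_minimal)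
    then show ?thesis using that by blast
  qed
  have h_attained: "\<exists>v\<in>V. \<phi> u v = h u" for u
    using Max_in[of "\<phi> u ` V"] V \<open>V \<noteq> {}\<close> unfolding h_def by (metis finite_imageI image_iff image_is_empty)
  have h_int: "\<exists>k::int. h u = k" for u
  proof -
    obtain v where "v \<in> V" "\<phi> u v = h u" using h_attained by blast
    moreover from this obtain i j where "v $ 1 = real_of_int i" "v $ 2 = real_of_int j"
      using V(2) integer_latticeE by (meson subsetD)
    ultimately have "h u = real_of_int (fst u * i + snd u * j)"
      by (simp add: \<phi>_def case_prod_beta)
    then show ?thesis by blast
  qed
  have h_pos: "0 < h u" if "u \<noteq> (0, 0)" for u
  proof -
    define w :: "real ^ 2" where "w = vector [real_of_int (fst u), real_of_int (snd u)]"
    obtain e where e: "0 < e" "ball 0 e \<subseteq> P"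
      using zero by (meson mem_interior)
    \<comment> \<open>With this factor \<open>s *\<^sub>R w\<close> falls into the ball inside
      \<open>P\<close>, and the functional with coefficient vector \<open>w\<close> is positive
      there.\<close>
    define s where "s = e / (2 * (norm w + 1))"
    have "0 < s" using e by (simp add: s_def add_nonneg_pos)
    have "norm (s *\<^sub>R w) < e"
    proof -
      have "s * norm w \<le> s * (norm w + 1)" using \<open>0 < s\<close> by simp
      also have "\<dots> = e / 2"
      proof -
        have "norm w + 1 \<noteq> 0" using norm_ge_zero[of w] by linarith
        then show ?thesis by (simp add: s_def field_simps)
      qed
      finally show ?thesis using \<open>0 < s\<close> e by simp
    qed
    then have "s *\<^sub>R w \<in> P" using e by (auto simp: dist_norm)
    then have "\<phi> u (s *\<^sub>R w) \<le> h u" by (rule h_ge)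
    moreover have "\<phi> u (s *\<^sub>R w) = s * ((fst u)\<^sup>2 + (snd u)\<^sup>2)"
      by (simp add: \<phi>_def w_def case_prod_beta power2_eq_square algebra_simps)
    moreover have "0 < (fst u)\<^sup>2 + (snd u)\<^sup>2"
      using that by (cases u) (auto simp: sum_power2_gt_zero_iff)
    then have "0 < s * ((fst u)\<^sup>2 + (snd u)\<^sup>2)"
      using \<open>0 < s\<close> by (metis mult_pos_pos of_int_0_less_iff)
    ultimately show ?thesis by linarith
  qed
  \<comment> \<open>A least element is taken among natural numbers; since \<open>h\<close> is
    integral and positive, \<open>nat\<close> and the floor lose nothing.\<close>
  obtain u where u: "u \<noteq> (0, 0)" "\<And>u'. u' \<noteq> (0, 0) \<Longrightarrow> nat \<lfloor>h u\<rfloor> \<le> nat \<lfloor>h u'\<rfloor>"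
    using ex_has_least_nat[of "\<lambda>u. u \<noteq> (0, 0)" "(1, 0)" "\<lambda>u. nat \<lfloor>h u\<rfloor>"] by auto
  obtain a b where ab: "u = (a, b)" by (cases u)
  obtain H where H: "h u = real_of_int H" using h_int by blast
  have H_pos: "0 < H" using h_pos[OF u(1)] H by simp
  have H_le: "H \<le> h u'" if "u' \<noteq> (0, 0)" for u'
  proof -
    obtain k where k: "h u' = real_of_int k" using h_int by blast
    then show ?thesis using u(2)[OF that] h_pos[OF that] H H_pos by simp
  qed
  have "gcd a b = 1"
  proof -
    define g where "g = gcd a b"
    have "0 < g" using u(1) ab by (auto simp: g_def)
    \<comment> \<open>Dividing the functional by \<open>g\<close> divides its maximum by
      \<open>g\<close>, so minimality of \<open>H\<close> forces \<open>g = 1\<close>.\<close>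
    obtain a' b' where g: "a = g * a'" "b = g * b'"
      unfolding g_def by (metis dvdE gcd_dvd1 gcd_dvd2)
    have "(a', b') \<noteq> (0, 0)" using u(1) ab g by auto
    obtain v where v: "v \<in> V" "\<phi> (a', b') v = h (a', b')" using h_attained by blast
    have "g * h (a', b') = \<phi> u v"
      unfolding v(2)[symmetric] by (simp add: \<phi>_def ab g algebra_simps)
    also have "\<dots> \<le> H" using h_ge[of v u] v \<open>V \<subseteq> P\<close> H by auto
    also have "\<dots> \<le> h (a', b')" by (rule H_le) fact
    finally have "g * h (a', b') \<le> 1 * h (a', b')" by simp
    then have "real_of_int g \<le> 1" using h_pos[OF \<open>(a', b') \<noteq> (0, 0)\<close>] mult_le_cancel_right_pos by blast
    then have "g \<le> 1" by simp
    then show ?thesis using \<open>0 < g\<close> unfolding g_def by linarith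
  qed
  then obtain c d where "c * b - d * a = 1"
    using bezout_int[of a b] by (metis add.commute diff_minus_eq_add mult_minus_left)
  then interpret unimodular a b c d by unfold_locales
  have basis_map_phi: "basis_map p $ 2 = \<phi> u p" for p by (simp add: \<phi>_def ab)
  interpret Q: wide_polygon "basis_map ` V" "basis_map ` P" H
  proof
    show "finite (basis_map ` V)" using V by simp
    show "basis_map ` V \<subseteq> integer_lattice" using V basis_map_lattice_iff by auto
    show "basis_map ` P = convex hull (basis_map ` V)"
      unfolding V(3) by (rule convex_hull_linear_image[OF linear_basis_map])
    show "- p \<in> basis_map ` P" if "p \<in> basis_map ` P" for p
    proof -
      obtain q where "q \<in> P" "p = basis_map q" using \<open>p \<in> basis_map ` P\<close> by blast
      moreover from this have "- q \<in> P" using P(4) by blast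
      ultimately show ?thesis using linear_neg[OF linear_basis_map] by (metis imageI)
    qed
    show "0 < H" by (rule H_pos)
    show "p $ 2 \<le> H" if "p \<in> basis_map ` P" for p
      using that h_ge[of _ u] unfolding H[symmetric] by (auto simp del: basis_map_component simp: basis_map_phi)
    show "\<exists>p\<in>basis_map ` P. p $ 2 = H"
      using h_attained[of u] \<open>V \<subseteq> P\<close> unfolding H[symmetric]
      by (auto simp del: basis_map_component simp: basis_map_phi)
    show "\<exists>v\<in>basis_map ` V. real_of_int H \<le> real_of_int k * v $ 1 + real_of_int l * v $ 2"
      if "k \<noteq> 0 \<or> l \<noteq> 0" for k l
    proof -
      \<comment> \<open>The pullback of the functional \<open>(k, l)\<close> along
        \<open>basis_map\<close>, nonzero because the matrix is invertible.\<close>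
      define u' where "u' = (k * c + l * a, k * d + l * b)"
      have "k = (k * c + l * a) * b - (k * d + l * b) * a"
        "l = (k * d + l * b) * c - (k * c + l * a) * d"
        using det by algebra+
      then have "u' \<noteq> (0, 0)" using that unfolding u'_def by auto
      obtain v where v: "v \<in> V" "\<phi> u' v = h u'" using h_attained by blast
      have "\<phi> u' v = k * basis_map v $ 1 + l * basis_map v $ 2"
        by (simp add: \<phi>_def u'_def algebra_simps)
      then show ?thesis using v H_le[OF \<open>u' \<noteq> (0, 0)\<close>] by auto
    qed
  qed
  define M where "M = max (Q.right_end 0) H"
  have M: "1 \<le> real_of_int H" "H \<le> M" using H_pos by (auto simp: M_def)
  have bound: "measure lebesgue P * (1 - 1 / (2 * M)) * (1 - 1 / (2 * real_of_int H))
      \<le> lattice_point_count (interior P)"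
    using Q.lattice_point_count_ge by (simp add: M_def lattice_point_count_basis_map measure_basis_map[OF P(1)])
  \<comment> \<open>In the new coordinates such a lattice point has height at least \<open>1\<close>
    in absolute value, while the dilate by \<open>l\<close> reaches only height
    \<open>l * H\<close>.\<close>
  have off_line: "1 / H \<le> l" if "0 < l" "v \<in> ((*\<^sub>R) l ` P) \<inter> integer_lattice" "basis_map v $ 2 \<noteq> 0" for l v
  proof -
    obtain p where p: "p \<in> P" "v = l *\<^sub>R p"
      using \<open>v \<in> ((*\<^sub>R) l ` P) \<inter> integer_lattice\<close> by auto
    have "basis_map v $ 2 \<in> \<int>"
      using that basis_map_lattice_iff[of v] by (auto simp: integer_lattice_def)
    then have "1 \<le> \<bar>basis_map v $ 2\<bar>" using that(3) by (rule Ints_nonzero_abs_ge1)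
    also have "\<bar>basis_map v $ 2\<bar> = l * \<bar>basis_map p $ 2\<bar>"
      using that(1) unfolding p(2) linear_cmul[OF linear_basis_map] by (simp add: abs_mult)
    also have "\<dots> \<le> l * H"
      using Q.height[of "basis_map p"] Q.height'[of "basis_map p"] p that(1) by (intro mult_left_mono) auto
    finally show ?thesis using M by (simp add: pos_divide_le_eq)
  qed
  have "0 \<in> P" using zero interior_subset by blast
  \<comment> \<open>Nonempty interior forces \<open>V\<close> to span the plane, and
    \<open>V\<close> consists of lattice points of \<open>P\<close>; so the factor \<open>1\<close>
    is admissible for both minima.\<close>
  have "\<not> dim P < 2"
    using empty_interior_lowdim[of P] P(3) by auto
  moreover have "dim P \<le> dim V"
    unfolding V(3) by (metis convex_hull_subset_span dim_span dim_subset)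
  moreover have "dim V \<le> dim (P \<inter> integer_lattice)"
    using V \<open>V \<subseteq> P\<close> by (intro dim_subset) auto
  ultimately have dimP: "2 \<le> dim (P \<inter> integer_lattice)" by linarith
  define l1 where "l1 = successive_minimum 1 P"
  define l2 where "l2 = successive_minimum 2 P"
  have l1: "0 < l1" "l1 \<le> 1" "1 \<le> dim (((*\<^sub>R) l1 ` P) \<inter> integer_lattice)"
    unfolding l1_def using successive_minimum_attained[OF P(1,2) \<open>0 \<in> P\<close>, of 1] dimP by simp_all
  have l2: "0 < l2" "l2 \<le> 1" "2 \<le> dim (((*\<^sub>R) l2 ` P) \<inter> integer_lattice)"
    unfolding l2_def using successive_minimum_attained[OF P(1,2) \<open>0 \<in> P\<close>, of 2] dimP by simp_all
  \<comment> \<open>Otherwise all lattice points of the dilate by \<open>l2\<close> lie on one line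
    through the origin.\<close>
  have "1 / H \<le> l2"
  proof (rule ccontr)
    assume "\<not> 1 / H \<le> l2"
    then have "basis_map v $ 2 = 0" if "v \<in> ((*\<^sub>R) l2 ` P) \<inter> integer_lattice" for v
      using off_line l2(1) that by blast
    moreover define n :: "real ^ 2" where "n = vector [real_of_int a, real_of_int b]"
    moreover have "basis_map v $ 2 = n \<bullet> v" for v
      by (simp add: n_def inner_vec_def sum_2)
    ultimately have "((*\<^sub>R) l2 ` P) \<inter> integer_lattice \<subseteq> {v. n \<bullet> v = 0}" by auto
    then have "dim (((*\<^sub>R) l2 ` P) \<inter> integer_lattice) \<le> dim {v. n \<bullet> v = 0}"
      by (rule dim_subset)
    also have "n \<noteq> 0"
      using u(1) ab by (auto simp: n_def vector_2_eq_iff)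
    then have "dim {v. n \<bullet> v = 0} = 1"
      using dim_hyperplane[of n] by simp
    finally show False using l2(3) by simp
  qed
  \<comment> \<open>A nonzero lattice point of the dilate is either off the line of height
    \<open>0\<close>, where \<open>off_line\<close> applies, or on it, where its first new
    coordinate is a nonzero integer of size at most \<open>l1 * Q.right_end 0\<close>.\<close>
  have "1 / M \<le> l1"
  proof -
    have "\<not> ((*\<^sub>R) l1 ` P) \<inter> integer_lattice \<subseteq> {0}"
      using dim_eq_0[of "((*\<^sub>R) l1 ` P) \<inter> integer_lattice"] l1(3) by linarith
    then obtain v where v: "v \<in> ((*\<^sub>R) l1 ` P) \<inter> integer_lattice" "v \<noteq> 0" by auto
    show ?thesis
    proof (cases "basis_map v $ 2 = 0")
      case False
      have "1 / M \<le> 1 / H" using M by (intro divide_left_mono) auto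
      then show ?thesis using off_line[OF l1(1) v(1) False] by linarith
    next
      case True
      obtain p where p: "p \<in> P" "v = l1 *\<^sub>R p" using v by auto
      have image_v: "basis_map v = l1 *\<^sub>R basis_map p" unfolding p(2) by (rule linear_cmul[OF linear_basis_map])
      then have "basis_map p $ 2 = real_of_int 0" using True l1(1) by simp
      then have "\<bar>basis_map p $ 1\<bar> \<le> Q.right_end 0"
        using Q.right_end_ge[of "basis_map p" 0] Q.left_end_le[of "basis_map p" 0] p by simp
      then have "\<bar>basis_map p $ 1\<bar> \<le> M" by (simp add: M_def)
      have "basis_map v $ 1 \<noteq> 0"
      proof
        assume "basis_map v $ 1 = 0"
        then have "v $ 1 = 0" "v $ 2 = 0"
          using basis_map_solve[of v, unfolded True \<open>basis_map v $ 1 = 0\<close>] by (simp_all only: mult_zero_right diff_self)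
        then show False using v(2) by (simp add: vector_2_eq_iff)
      qed
      moreover have "basis_map v $ 1 \<in> \<int>"
        using v basis_map_lattice_iff[of v] by (auto simp: integer_lattice_def)
      ultimately have "1 \<le> \<bar>basis_map v $ 1\<bar>" by (intro Ints_nonzero_abs_ge1)
      also have "\<bar>basis_map v $ 1\<bar> = l1 * \<bar>basis_map p $ 1\<bar>"
        using l1(1) unfolding image_v by (simp add: abs_mult)
      also have "\<dots> \<le> l1 * M"
        using \<open>\<bar>basis_map p $ 1\<bar> \<le> M\<close> l1(1) by (intro mult_left_mono) auto
      finally show ?thesis using M by (simp add: pos_divide_le_eq)
    qed
  qed
  \<comment> \<open>Monotonicity of the product needs nonnegative factors, which
    \<open>M >= 1\<close> and \<open>l2 <= 1\<close> provide.\<close>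
  have "(1 - l1 / 2) * (1 - l2 / 2) \<le> (1 - 1 / (2 * M)) * (1 - 1 / (2 * real_of_int H))"
    using \<open>1 / M \<le> l1\<close> \<open>1 / H \<le> l2\<close> l1 l2 M by (intro mult_mono) auto
  then have "measure lebesgue P * ((1 - l1 / 2) * (1 - l2 / 2))
      \<le> measure lebesgue P * ((1 - 1 / (2 * M)) * (1 - 1 / (2 * real_of_int H)))"
    by (intro mult_left_mono) auto
  then show ?thesis
    using bound unfolding l1_def l2_def by (simp add: mult.assoc)
qed

end
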